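(* Let $\mathbb{F}_q$ be a finite field with $q$ elements, let $d\ge 1$ be an integer and let $P(Z)\in\mathbb{F}_q[Z]$ with $\deg P\ge 2$. Let $$S_d(\mathbb{F}_q)=\{(\alpha,\beta,\gamma)\in\mathbb{F}_q^3\mid \alpha^d\beta=P(\gamma)\},\qquad N_0=\#\{\gamma\in\mathbb{F}_q\mid P(\gamma)=0\}.$$ Then $$|S_d(\mathbb{F}_q)|=qN_0+q(q-1)=q(q-1+N_0).$$
   Context: $S_d$ is the Danielewski surface $X^dY=P(Z)$ over $\mathbb{F}_q$, and $S_d(\mathbb{F}_q)$ is its set of $\mathbb{F}_q$-rational points. *)

theory Defs
  imports "HOL-Computational_Algebra.Polynomial" "HOL-Library.Cardinality"
begin

definition danielewski_points :: "nat \<Rightarrow> 'a::field poly \<Rightarrow> ('a \<times> 'a \<times> 'a) set" where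
  "danielewski_points d P = {(\<alpha>, \<beta>, \<gamma>). \<alpha> ^ d * \<beta> = poly P \<gamma>}"

end

(* The first coordinate splits the surface in two: over \<alpha> = 0 the equation reads P(\<gamma>) = 0
   with \<beta> free, and over \<alpha> \<noteq> 0 it is the graph \<beta> = P(\<gamma>) / \<alpha>^d. *)
theory Submission
  imports Defs
begin

text \<open>Writing the pieces as a product and as an image of a product lets their cardinalities be
  read off.\<close>

lemma danielewski_points_decomp:
  fixes P :: "'a::field poly"
  assumes "d \<ge> 1"
  shows "danielewski_points d P =
    {0} \<times> UNIV \<times> {\<gamma>. poly P \<gamma> = 0} \<union>
    (\<lambda>(\<alpha>, \<gamma>). (\<alpha>, poly P \<gamma> / \<alpha> ^ d, \<gamma>)) ` ((UNIV - {0}) \<times> UNIV)"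
    (is "_ = ?A \<union> ?B")
proof (rule set_eqI)
  fix x :: "'a \<times> 'a \<times> 'a"
  obtain \<alpha> \<beta> \<gamma> where x: "x = (\<alpha>, \<beta>, \<gamma>)" by (cases x)
  have "x \<in> danielewski_points d P \<longleftrightarrow> \<alpha> ^ d * \<beta> = poly P \<gamma>"
    by (simp add: x danielewski_points_def)
  \<comment> \<open>Here \<open>d \<ge> 1\<close> enters: it gives \<open>0 ^ d = 0\<close>, whereas
    \<open>0 ^ 0 = 1\<close>.\<close>
  also have "\<dots> \<longleftrightarrow> \<alpha> = 0 \<and> poly P \<gamma> = 0 \<or> \<alpha> \<noteq> 0 \<and> \<beta> = poly P \<gamma> / \<alpha> ^ d"
    using assms by (cases "\<alpha> = 0") (auto simp: power_0_left field_simps)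
  also have "\<dots> \<longleftrightarrow> x \<in> ?A \<union> ?B"
    by (auto simp: x image_iff)
  finally show "x \<in> danielewski_points d P \<longleftrightarrow> x \<in> ?A \<union> ?B" .
qed

theorem mainTheorem2:
  fixes P :: "'a::{field,finite} poly" and d q N\<^sub>0 :: nat
  assumes "q = CARD('a)"
    and "d \<ge> 1"
    and "degree P \<ge> 2"
    and "N\<^sub>0 = card {\<gamma>. poly P \<gamma> = 0}"
  shows "card (danielewski_points d P) = q * N\<^sub>0 + q * (q - 1) \<and>
         q * N\<^sub>0 + q * (q - 1) = q * (q - 1 + N\<^sub>0)"
proof
  let ?f = "\<lambda>(\<alpha>, \<gamma>). (\<alpha>, poly P \<gamma> / \<alpha> ^ d, \<gamma>)"
  let ?A = "{0::'a} \<times> (UNIV::'a set) \<times> {\<gamma>. poly P \<gamma> = 0}"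
  let ?B = "?f ` ((UNIV - {0}) \<times> UNIV)"
  have "card ?A = q * N\<^sub>0"
    using assms by (simp add: card_cartesian_product)
  \<comment> \<open>\<open>?f\<close> keeps both parameters as coordinates, so it is
    injective.\<close>
  moreover have "card ?B = (q - 1) * q"
    using assms by (subst card_image) (auto simp: inj_on_def card_cartesian_product card_Diff_singleton)
  \<comment> \<open>The first coordinate is zero on \<open>?A\<close> and nonzero on
    \<open>?B\<close>; finiteness comes from the type.\<close>
  moreover have "card (?A \<union> ?B) = card ?A + card ?B"
    by (rule card_Un_disjoint) auto
  ultimately show "card (danielewski_points d P) = q * N\<^sub>0 + q * (q - 1)"
    using assms(2) by (simp add: danielewski_points_decomp mult.commute)
  \<comment> \<open>Truncated subtraction is harmless: \<open>q - 1\<close> stays intact as one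
    summand.\<close>
  show "q * N\<^sub>0 + q * (q - 1) = q * (q - 1 + N\<^sub>0)"
    by (simp add: distrib_left)
qed

end
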